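(* Let $G$ be a compact group with unit element $1$ and normalized Haar measure $\mu$, and let $A\subset G$ be a subset with $A=A^{-1}$ and $1\in A$; write $A^c=G\setminus A$. Assume that there exists a $\mu$-measurable positive definite function $h:G\to\mathbb{R}$ such that $h(x)\le 0$ for all $x\in A^c$ and $\int_G h\,d\mu>0$. Then every finite set $B=\{b_1,\dots,b_m\}\subset G$ such that $b_j^{-1}b_k\in A^c\cup\{1\}$ for all $j,k\in\{1,\dots,m\}$ satisfies $$|B|\le \frac{h(1)}{\int_G h\,d\mu}.$$
   Context: A function $h:G\to\mathbb{C}$ on a group $G$ is called positive definite if for any $m$, any $u_1,\dots,u_m\in G$ and any $c_1,\dots,c_m\in\mathbb{C}$ we have $\sum_{i,j=1}^m h(u_i^{-1}u_j)\,\overline{c_i}\,c_j\ge 0$ (in particular the sum is real). The normalized Haar measure is the Haar measure with $\mu(G)=1$. $A^{-1}=\{a^{-1}:a\in A\}$, and $|B|$ denotes the cardinality of $B$. *)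

theory Defs
  imports "HOL-Analysis.Analysis" "HOL-Algebra.Coset"
begin

locale topological_group = group G for G (structure) +
  fixes T :: "'a topology"
  assumes topspace_eq_carrier: "topspace T = carrier G"
    and continuous_mult: "continuous_map (prod_topology T T) T (\<lambda>(x, y). x \<otimes> y)"
    and continuous_inv: "continuous_map T T (\<lambda>x. inv x)"

text \<open>As usual, compact groups are understood to be Hausdorff.\<close>

locale compact_group = topological_group G T for G (structure) and T +
  assumes compact: "compact_space T"
    and Hausdorff: "Hausdorff_space T"

text \<open>A left Haar measure is a nonzero left-invariant Radon measure on the Borel sets. In
  a compact group it is automatically right-invariant as well.\<close>

definition haar_measure :: "('a, 'b) monoid_scheme \<Rightarrow> 'a topology \<Rightarrow> 'a measure \<Rightarrow> bool" where
  "haar_measure G T \<mu> \<longleftrightarrow>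
     space \<mu> = topspace T \<and>
     sets \<mu> = sigma_sets (topspace T) {U. openin T U} \<and>
     emeasure \<mu> (space \<mu>) \<noteq> 0 \<and>
     (\<forall>g \<in> carrier G. \<forall>E \<in> sets \<mu>. emeasure \<mu> (g <#\<^bsub>G\<^esub> E) = emeasure \<mu> E) \<and>
     (\<forall>K. compactin T K \<longrightarrow> emeasure \<mu> K < \<infinity>) \<and>
     (\<forall>E \<in> sets \<mu>. emeasure \<mu> E = (INF U \<in> {U. openin T U \<and> E \<subseteq> U}. emeasure \<mu> U)) \<and>
     (\<forall>U. openin T U \<longrightarrow>
        emeasure \<mu> U = (SUP K \<in> {K. compactin T K \<and> K \<subseteq> U}. emeasure \<mu> K))"

definition normalized_haar_measure ::
    "('a, 'b) monoid_scheme \<Rightarrow> 'a topology \<Rightarrow> 'a measure \<Rightarrow> bool" where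
  "normalized_haar_measure G T \<mu> \<longleftrightarrow> haar_measure G T \<mu> \<and> emeasure \<mu> (space \<mu>) = 1"

definition positive_definite :: "('a, 'b) monoid_scheme \<Rightarrow> ('a \<Rightarrow> complex) \<Rightarrow> bool" where
  "positive_definite G h \<longleftrightarrow>
     (\<forall>(m :: nat) (u :: nat \<Rightarrow> 'a) (c :: nat \<Rightarrow> complex).
        (\<forall>i \<in> {1..m}. u i \<in> carrier G) \<longrightarrow>
        (\<Sum>i = 1..m. \<Sum>j = 1..m. h (inv\<^bsub>G\<^esub> (u i) \<otimes>\<^bsub>G\<^esub> u j) * cnj (c i) * c j) \<in> \<real>\<^sub>\<ge>\<^sub>0)"

end

theory Submission
  imports Defs
begin

text \<open>Let \<open>I\<close> be the integral of \<open>h\<close> and let \<open>\<kappa>\<close> be the infimum of the values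
  \<open>\<Sum>\<^sub>i\<^sub>j c\<^sub>i c\<^sub>j h (u\<^sub>i\<inverse> u\<^sub>j)\<close> over all real weights of total mass \<open>1\<close>. Adjoining one further point
  \<open>x\<close> with weight \<open>d\<close> and averaging over \<open>x\<close> yields \<open>\<kappa> (1 + d)\<^sup>2 \<le> \<kappa> + d\<^sup>2 h(1) + 2 d I\<close>, and
  letting \<open>d\<close> tend to \<open>0\<close> from below gives \<open>\<kappa> \<ge> I\<close>. Hence \<open>m\<^sup>2 I\<close> is at most the sum of the
  \<open>h (b\<^sub>j\<inverse> b\<^sub>k)\<close>, which is at most \<open>m h(1)\<close> because its off-diagonal terms are not positive.
  Averaging over a single point avoids integrating \<open>h (x\<inverse> y)\<close> over \<open>G \<times> G\<close>, where it need not be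
  measurable for the product of the Borel \<open>\<sigma>\<close>-algebras.\<close>

section \<open>The quadratic form of a positive definite function\<close>

definition translation_form ::
    "('a, 'b) monoid_scheme \<Rightarrow> ('a \<Rightarrow> real) \<Rightarrow> nat \<Rightarrow> (nat \<Rightarrow> 'a) \<Rightarrow> (nat \<Rightarrow> real) \<Rightarrow> real" where
  "translation_form G h m u c =
     (\<Sum>i = 1..m. \<Sum>j = 1..m. h (inv\<^bsub>G\<^esub> (u i) \<otimes>\<^bsub>G\<^esub> u j) * c i * c j)"

lemma translation_form_nonneg:
  assumes "positive_definite G (\<lambda>x. complex_of_real (h x))" "\<And>i. i \<in> {1..m} \<Longrightarrow> u i \<in> carrier G"
  shows "translation_form G h m u c \<ge> 0"
proof -
  have "\<forall>c :: nat \<Rightarrow> complex. (\<Sum>i = 1..m. \<Sum>j = 1..m.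
      complex_of_real (h (inv\<^bsub>G\<^esub> (u i) \<otimes>\<^bsub>G\<^esub> u j)) * cnj (c i) * c j) \<in> \<real>\<^sub>\<ge>\<^sub>0"
    using assms unfolding positive_definite_def by simp
  from this[rule_format, of "\<lambda>i. complex_of_real (c i)"]
  have "complex_of_real (translation_form G h m u c) \<in> \<real>\<^sub>\<ge>\<^sub>0"
    by (simp add: translation_form_def)
  then show ?thesis
    by simp
qed

lemma translation_form_scale:
  "translation_form G h m u (\<lambda>i. r * c i) = r\<^sup>2 * translation_form G h m u c"
  unfolding translation_form_def sum_distrib_left
  by (intro sum.cong refl) (simp add: power2_eq_square)

context group
begin

text \<open>With weight \<open>1\<close> at \<open>x\<close> and \<open>\<i>\<close> at
  \<open>y\<close>, the two values of the real function \<open>h\<close> differ by the imaginary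
  part of a sum that has to be real.\<close>

lemma positive_definite_symmetric:
  assumes pd: "positive_definite G (\<lambda>x. complex_of_real (h x))"
    and x: "x \<in> carrier G" and y: "y \<in> carrier G"
  shows "h (inv x \<otimes> y) = h (inv y \<otimes> x)"
proof -
  define u where "u = (\<lambda>i::nat. if i = 1 then x else y)"
  define c where "c = (\<lambda>i::nat. if i = 1 then 1 else \<i>)"
  have "(\<Sum>i = 1..2. \<Sum>j = 1..2. complex_of_real (h (inv (u i) \<otimes> u j)) * cnj (c i) * c j) \<in> \<real>\<^sub>\<ge>\<^sub>0"
    using pd x y unfolding positive_definite_def u_def by auto
  then have "Im (\<Sum>i = 1..2. \<Sum>j = 1..2. complex_of_real (h (inv (u i) \<otimes> u j)) * cnj (c i) * c j) = 0"
    by (simp add: complex_nonneg_Reals_iff)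
  moreover have "{1..2::nat} = {1, 2}"
    by auto
  ultimately show ?thesis
    by (simp add: u_def c_def)
qed

text \<open>Symmetry of \<open>h\<close> merges the two cross sums, so the new point
  \<open>x\<close> enters only through left translates of \<open>h\<close>. It may coincide with
  some \<open>u i\<close>.\<close>

lemma translation_form_append:
  assumes pd: "positive_definite G (\<lambda>x. complex_of_real (h x))"
    and u: "\<And>i. i \<in> {1..m} \<Longrightarrow> u i \<in> carrier G" and x: "x \<in> carrier G"
  shows "translation_form G h (Suc m) (u(Suc m := x)) (c(Suc m := d)) =
    translation_form G h m u c + d\<^sup>2 * h \<one> + 2 * d * (\<Sum>i = 1..m. c i * h (inv (u i) \<otimes> x))"
proof -
  have "(\<Sum>i = 1..m. h (inv x \<otimes> u i) * d * c i) = d * (\<Sum>i = 1..m. c i * h (inv (u i) \<otimes> x))"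
    unfolding sum_distrib_left
    by (intro sum.cong refl) (simp add: positive_definite_symmetric[OF pd x u])
  moreover have "(\<Sum>i = 1..m. h (inv (u i) \<otimes> x) * c i * d) =
      d * (\<Sum>i = 1..m. c i * h (inv (u i) \<otimes> x))"
    unfolding sum_distrib_left by (intro sum.cong refl) simp
  ultimately show ?thesis
    using x by (simp add: translation_form_def sum.distrib power2_eq_square)
qed

end

section \<open>Left translations and Haar integration\<close>

context compact_group
begin

lemma translation_measurable:
  assumes "haar_measure G T \<mu>" and g: "g \<in> carrier G"
  shows "(\<lambda>x. g \<otimes> x) \<in> measurable \<mu> \<mu>"
proof (rule measurable_sigma_sets)
  show "sets \<mu> = sigma_sets (topspace T) {U. openin T U}"
    using assms by (simp add: haar_measure_def)
  show "{U. openin T U} \<subseteq> Pow (topspace T)"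
    using openin_subset by auto
  have sp: "space \<mu> = topspace T"
    using assms by (simp add: haar_measure_def)
  then show "(\<lambda>x. g \<otimes> x) \<in> space \<mu> \<rightarrow> topspace T"
    using g topspace_eq_carrier by auto
  fix U assume "U \<in> {U. openin T U}"
  moreover have "continuous_map T (prod_topology T T) (\<lambda>x. (g, x))"
    using g topspace_eq_carrier by (simp add: continuous_map_pairwise o_def)
  then have "continuous_map T T ((\<lambda>(x, y). x \<otimes> y) \<circ> (\<lambda>x. (g, x)))"
    using continuous_mult by (rule continuous_map_compose)
  ultimately have "openin T {x \<in> topspace T. g \<otimes> x \<in> U}"
    by (simp add: continuous_map_def)
  moreover have "(\<lambda>x. g \<otimes> x) -` U \<inter> space \<mu> = {x \<in> topspace T. g \<otimes> x \<in> U}"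
    using sp by auto
  ultimately show "(\<lambda>x. g \<otimes> x) -` U \<inter> space \<mu> \<in> sets \<mu>"
    using assms by (auto simp: haar_measure_def)
qed

lemma distr_translation:
  assumes \<mu>: "haar_measure G T \<mu>" and g: "g \<in> carrier G"
  shows "distr \<mu> \<mu> (\<lambda>x. g \<otimes> x) = \<mu>"
proof (rule measure_eqI)
  fix E assume "E \<in> sets (distr \<mu> \<mu> (\<lambda>x. g \<otimes> x))"
  then have E: "E \<in> sets \<mu>"
    by simp
  have sp: "space \<mu> = carrier G"
    using \<mu> topspace_eq_carrier by (simp add: haar_measure_def)
  have "E \<subseteq> carrier G"
    using sets.sets_into_space[OF E] sp by simp
  then have "(\<lambda>x. g \<otimes> x) -` E \<inter> space \<mu> = inv g <# E"
    using g sp by (force simp: l_coset_def inv_solve_left m_assoc[symmetric])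
  then show "emeasure (distr \<mu> \<mu> (\<lambda>x. g \<otimes> x)) E = emeasure \<mu> E"
    using \<mu> g E translation_measurable[OF \<mu> g] by (simp add: emeasure_distr haar_measure_def)
qed simp

text \<open>Translation preserves \<open>\<mu>\<close>, so preimages of null sets are null; this
  carries measurability and invariance over to the completion, where \<open>h\<close> is
  measurable.\<close>

lemma distr_completion_translation:
  assumes \<mu>: "haar_measure G T \<mu>" and g: "g \<in> carrier G"
  shows "(\<lambda>x. g \<otimes> x) \<in> measurable (completion \<mu>) (completion \<mu>)"
    and "distr (completion \<mu>) (completion \<mu>) (\<lambda>x. g \<otimes> x) = completion \<mu>"
proof -
  have meas: "(\<lambda>x. g \<otimes> x) \<in> measurable (completion \<mu>) \<mu>"
    using translation_measurable[OF \<mu> g] by (rule measurable_completion)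
  have distr: "distr (completion \<mu>) \<mu> (\<lambda>x. g \<otimes> x) = \<mu>"
    using translation_measurable[OF \<mu> g] distr_translation[OF \<mu> g] by (simp add: distr_completion)
  show "(\<lambda>x. g \<otimes> x) \<in> measurable (completion \<mu>) (completion \<mu>)"
    using meas by (rule completion.measurable_completion2) (simp add: distr)
  show "distr (completion \<mu>) (completion \<mu>) (\<lambda>x. g \<otimes> x) = completion \<mu>"
    using completion.completion_distr_eq[OF meas] by (simp add: distr)
qed

lemma has_bochner_integral_translation:
  fixes h :: "'a \<Rightarrow> real"
  assumes \<mu>: "haar_measure G T \<mu>" and g: "g \<in> carrier G" and h: "integrable (completion \<mu>) h"
  shows "has_bochner_integral (completion \<mu>) (\<lambda>x. h (g \<otimes> x)) (LINT x|completion \<mu>. h x)"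
proof -
  note meas = distr_completion_translation(1)[OF \<mu> g]
    and distr = distr_completion_translation(2)[OF \<mu> g]
  have hm: "h \<in> borel_measurable (completion \<mu>)"
    using h by (rule borel_measurable_integrable)
  have "integrable (completion \<mu>) (\<lambda>x. h (g \<otimes> x))"
    using integrable_distr_eq[OF meas hm] h unfolding distr by (rule iffD1)
  moreover have "(LINT x|completion \<mu>. h x) = (LINT x|completion \<mu>. h (g \<otimes> x))"
    using integral_distr[OF meas hm] unfolding distr .
  ultimately show ?thesis
    by (simp add: has_bochner_integral_iff)
qed

text \<open>Equivalently, subtracting its mean from \<open>h\<close> leaves a form that is still
  nonnegative for real weights.\<close>

lemma integral_le_translation_form:
  fixes h :: "'a \<Rightarrow> real"
  assumes \<mu>: "normalized_haar_measure G T \<mu>"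
    and pd: "positive_definite G (\<lambda>x. complex_of_real (h x))"
    and h: "integrable (completion \<mu>) h"
    and u: "\<And>i. i \<in> {1..m} \<Longrightarrow> u i \<in> carrier G"
  shows "(\<Sum>i = 1..m. c i)\<^sup>2 * (LINT x|completion \<mu>. h x) \<le> translation_form G h m u c"
proof -
  have haar: "haar_measure G T \<mu>" and total: "emeasure \<mu> (space \<mu>) = 1"
    using \<mu> by (auto simp: normalized_haar_measure_def)
  have space: "space (completion \<mu>) = carrier G"
    using haar topspace_eq_carrier by (simp add: haar_measure_def)
  interpret \<mu>: finite_measure "completion \<mu>"
    using total by (intro finite_measureI) simp
  have const: "has_bochner_integral (completion \<mu>) (\<lambda>_. a) a" for a :: real
    using total by (simp add: has_bochner_integral_iff measure_def)
  define I where "I = (LINT x|completion \<mu>. h x)"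
  \<comment> \<open>The number of points varies, so that forms with one more point are controlled by
    the same infimum.\<close>
  define S where "S = {translation_form G h m u c |m u c.
    (\<forall>i \<in> {1..m}. u i \<in> carrier G) \<and> (\<Sum>i = 1..m. c i) = 1}"
  define \<kappa> where "\<kappa> = Inf S"
  have bdd: "bdd_below S"
    using translation_form_nonneg[OF pd] by (intro bdd_belowI[of _ 0]) (auto simp: S_def)
  have "translation_form G h 1 (\<lambda>_. \<one>) (\<lambda>_. 1) \<in> S"
    unfolding S_def by force
  then have ne: "S \<noteq> {}"
    by auto
  \<comment> \<open>Homogeneity reduces nonzero total mass to mass \<open>1\<close>; for mass zero
    the left side vanishes and nonnegativity suffices.\<close>
  have scaled: "(\<Sum>i = 1..n. b i)\<^sup>2 * \<kappa> \<le> translation_form G h n v b"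
    if v: "\<And>i. i \<in> {1..n} \<Longrightarrow> v i \<in> carrier G" for n v b
  proof (cases "(\<Sum>i = 1..n. b i) = 0")
    case True
    then show ?thesis
      using translation_form_nonneg[OF pd, of n v b] v by simp
  next
    case False
    define s where "s = (\<Sum>i = 1..n. b i)"
    have "(\<Sum>i = 1..n. inverse s * b i) = 1"
      using False by (simp add: sum_distrib_left[symmetric] s_def)
    then have "translation_form G h n v (\<lambda>i. inverse s * b i) \<in> S"
      unfolding S_def using v by blast
    then have "\<kappa> \<le> (inverse s)\<^sup>2 * translation_form G h n v b"
      using cInf_lower[OF _ bdd] by (simp add: \<kappa>_def translation_form_scale)
    then have "s\<^sup>2 * \<kappa> \<le> s\<^sup>2 * ((inverse s)\<^sup>2 * translation_form G h n v b)"
      by (rule mult_left_mono) simp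
    moreover have "s\<^sup>2 * (inverse s)\<^sup>2 = 1"
      using False by (simp add: s_def flip: power_mult_distrib)
    ultimately show ?thesis
      by (simp add: s_def flip: mult.assoc)
  qed
  have step: "(1 + d)\<^sup>2 * \<kappa> \<le> \<kappa> + d\<^sup>2 * h \<one> + 2 * d * I" for d
  proof -
    \<comment> \<open>The bound is shown for each form \<open>q\<close> of mass \<open>1\<close>,
      with \<open>(1 + d)\<^sup>2\<close> the squared mass after adjoining a point; the infimum over
      \<open>q\<close> comes last.\<close>
    have "(1 + d)\<^sup>2 * \<kappa> - d\<^sup>2 * h \<one> - 2 * d * I \<le> q" if "q \<in> S" for q
    proof -
      obtain n v b where q: "q = translation_form G h n v b"
        and v: "\<And>i. i \<in> {1..n} \<Longrightarrow> v i \<in> carrier G" and b: "(\<Sum>i = 1..n. b i) = 1"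
        using \<open>q \<in> S\<close> unfolding S_def by blast
      define f where "f x = q + d\<^sup>2 * h \<one> + 2 * d * (\<Sum>i = 1..n. b i * h (inv (v i) \<otimes> x))" for x
      have lower: "(1 + d)\<^sup>2 * \<kappa> \<le> f x" if x: "x \<in> space (completion \<mu>)" for x
      proof -
        have "(\<Sum>i = 1..Suc n. (b(Suc n := d)) i)\<^sup>2 * \<kappa> \<le>
            translation_form G h (Suc n) (v(Suc n := x)) (b(Suc n := d))"
          using v x space by (intro scaled) auto
        moreover have "(\<Sum>i = 1..n. (b(Suc n := d)) i) = (\<Sum>i = 1..n. b i)"
          by (intro sum.cong) auto
        ultimately show ?thesis
          using translation_form_append[OF pd v, where x = x and c = b and d = d] x b space by (simp add: f_def q)
      qed
      have f: "has_bochner_integral (completion \<mu>) f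
          (q + d\<^sup>2 * h \<one> + 2 * d * (\<Sum>i = 1..n. b i * I))"
        unfolding f_def I_def using v
        by (intro has_bochner_integral_add has_bochner_integral_mult_right
            has_bochner_integral_sum const has_bochner_integral_translation[OF haar _ h] inv_closed)
      have "(LINT x|completion \<mu>. (1 + d)\<^sup>2 * \<kappa>) \<le> integral\<^sup>L (completion \<mu>) f"
        using integrable.intros[OF const] integrable.intros[OF f] lower by (rule integral_mono)
      then have "(1 + d)\<^sup>2 * \<kappa> \<le> q + d\<^sup>2 * h \<one> + 2 * d * (\<Sum>i = 1..n. b i * I)"
        unfolding has_bochner_integral_integral_eq[OF const] has_bochner_integral_integral_eq[OF f] .
      then show ?thesis
        using b by (simp add: sum_distrib_right[symmetric])
    qed
    then have "(1 + d)\<^sup>2 * \<kappa> - d\<^sup>2 * h \<one> - 2 * d * I \<le> \<kappa>"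
      unfolding \<kappa>_def by (rule cInf_greatest[OF ne])
    then show ?thesis
      by simp
  qed
  have "I \<le> \<kappa>"
  proof (rule ccontr)
    assume "\<not> I \<le> \<kappa>"
    \<comment> \<open>At \<open>d = - t\<close> the inequality \<open>step\<close> gives
      \<open>2 * (I - \<kappa>) \<le> t * (h \<one> - \<kappa>)\<close>. This \<open>t\<close> makes
      the right side at most \<open>I - \<kappa>\<close>; the added \<open>1\<close> keeps the
      denominator positive.\<close>
    define t where "t = (I - \<kappa>) / (\<bar>h \<one> - \<kappa>\<bar> + 1)"
    have t: "t > 0" "t * (\<bar>h \<one> - \<kappa>\<bar> + 1) = I - \<kappa>"
      using \<open>\<not> I \<le> \<kappa>\<close> by (auto simp: t_def)
    have "t * (2 * (I - \<kappa>)) \<le> t * (t * (h \<one> - \<kappa>))"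
      using step[of "- t"] by (simp add: power2_eq_square algebra_simps)
    then have "2 * (I - \<kappa>) \<le> t * (h \<one> - \<kappa>)"
      using t by simp
    also have "\<dots> \<le> t * (\<bar>h \<one> - \<kappa>\<bar> + 1)"
      using t by (intro mult_left_mono) auto
    finally show False
      using t \<open>\<not> I \<le> \<kappa>\<close> by simp
  qed
  then have "(\<Sum>i = 1..m. c i)\<^sup>2 * I \<le> (\<Sum>i = 1..m. c i)\<^sup>2 * \<kappa>"
    by (rule mult_left_mono) simp
  also have "\<dots> \<le> translation_form G h m u c"
    using u by (rule scaled)
  finally show ?thesis
    by (simp add: I_def)
qed

end

section \<open>The cardinality bound\<close>

theorem theorem2p3:
  fixes G :: "('a, 'b) monoid_scheme" (structure)
    and T :: "'a topology"
    and \<mu> :: "'a measure"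
    and A B :: "'a set"
    and h :: "'a \<Rightarrow> real"
  assumes "compact_group G T"
    and "normalized_haar_measure G T \<mu>"
    and "A \<subseteq> carrier G" and "A = set_inv A" and "\<one> \<in> A"
    and "h \<in> borel_measurable (completion \<mu>)"
    and "positive_definite G (\<lambda>x. complex_of_real (h x))"
    and "\<And>x. x \<in> carrier G - A \<Longrightarrow> h x \<le> 0"
    and "(LINT x|completion \<mu>. h x) > 0"
    and "finite B" and "B \<subseteq> carrier G"
    and "\<And>x y. x \<in> B \<Longrightarrow> y \<in> B \<Longrightarrow> inv x \<otimes> y \<in> (carrier G - A) \<union> {\<one>}"
  shows "real (card B) \<le> h \<one> / (LINT x|completion \<mu>. h x)"
proof -
  interpret compact_group G T
    by fact
  define I where "I = (LINT x|completion \<mu>. h x)"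
  have "I > 0"
    using assms by (simp add: I_def)
  \<comment> \<open>The integral of a non-integrable function is \<open>0\<close> by convention, so
    a positive integral forces integrability.\<close>
  have h: "integrable (completion \<mu>) h"
    using assms not_integrable_integral_eq[of "completion \<mu>" h] by fastforce
  have "0 \<le> translation_form G h 1 (\<lambda>_. \<one>) (\<lambda>_. 1)"
    using assms(7) by (rule translation_form_nonneg) simp
  then have "0 \<le> h \<one>"
    by (simp add: translation_form_def)
  obtain b where b: "bij_betw b {1..card B} B"
    using ex_bij_betw_nat_finite_1[OF \<open>finite B\<close>] by blast
  have off_diagonal: "h (inv x \<otimes> y) \<le> (if x = y then h \<one> else 0)" if "x \<in> B" "y \<in> B" for x y
  proof -
    have xy: "x \<in> carrier G" "y \<in> carrier G"
      using that \<open>B \<subseteq> carrier G\<close> by auto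
    \<comment> \<open>Distinct points thus give \<open>inv x \<otimes> y\<close> different from
      \<open>\<one>\<close>, hence outside \<open>A\<close>, where \<open>h\<close> is at most
      \<open>0\<close>.\<close>
    have "x = y" if "inv x \<otimes> y = \<one>"
      using inv_solve_left[OF xy(2) xy(1) one_closed] that xy
      by (metis inv_equality inv_inv inv_closed)
    then show ?thesis
      using assms(8,12) that xy by fastforce
  qed
  have "(\<Sum>i = 1..card B. (1::real))\<^sup>2 * I \<le> translation_form G h (card B) b (\<lambda>_. 1)"
    unfolding I_def using assms(2,7) h
    by (rule integral_le_translation_form) (use b \<open>B \<subseteq> carrier G\<close> in \<open>auto simp: bij_betw_def\<close>)
  also have "\<dots> = (\<Sum>x\<in>B. \<Sum>y\<in>B. h (inv x \<otimes> y))"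
    unfolding translation_form_def by (simp flip: sum.reindex_bij_betw[OF b])
  also have "\<dots> \<le> (\<Sum>x\<in>B. \<Sum>y\<in>B. if x = y then h \<one> else 0)"
    by (intro sum_mono off_diagonal)
  also have "\<dots> = card B * h \<one>"
    using \<open>finite B\<close> by simp
  finally have "card B * (card B * I) \<le> card B * h \<one>"
    by (simp add: power2_eq_square mult.assoc)
  \<comment> \<open>One factor \<open>card B\<close> cancels; for empty \<open>B\<close> the claim
    is \<open>0 \<le> h \<one>\<close>.\<close>
  then have "card B * I \<le> h \<one>"
    using \<open>0 \<le> h \<one>\<close> by (cases "card B = 0") auto
  then show ?thesis
    using \<open>I > 0\<close> by (simp add: I_def[symmetric] pos_le_divide_eq)
qed

end
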